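(* Let $M$ be an infinite subset of $\mathbb{N}$, $l\in\mathbb{N}$ and $\mathcal{F}$ be a regular thin family. Then for every finite partition $\mathrm{Plm}_l(\mathcal{F}\upharpoonright M)=\bigcup_{i=1}^p\mathcal{P}_i$, there exist $L\in[M]^\infty$ and $1\leq i_0\leq p$ such that $\mathrm{Plm}_l(\mathcal{F}\upharpoonright L)\subseteq\mathcal{P}_{i_0}$.
   Context: $\mathbb{N}=\{1,2,\dots\}$. For $M\subseteq\mathbb{N}$, $[M]^{<\infty}$ and $[M]^\infty$ denote the sets of finite, respectively infinite, subsets of $M$. For $s\subseteq\mathbb{N}$, $s(k)$ is the $k$-th element of $s$ in increasing order and $|s|$ its cardinality. $t\sqsubseteq s$ means that $t$ is an initial segment of $s$. For $\mathcal{F}\subseteq[\mathbb{N}]^{<\infty}$, $\mathcal{F}\upharpoonright M=\mathcal{F}\cap[M]^{<\infty}$ and $\widehat{\mathcal{F}}=\{t\in[\mathbb{N}]^{<\infty}:\exists s\in\mathcal{F},\ t\sqsubseteq s\}$. A nonempty family $\mathcal{R}\subseteq[\mathbb{N}]^{<\infty}$ is regular if it is hereditary (closed under subsets), spreading (if $\{n_1<\dots<n_k\}\in\mathcal{R}$, $m_1<\dots<m_k$ and $n_i\leq m_i$ for all $i$, then $\{m_1,\dots,m_k\}\in\mathcal{R}$) and compact (the set of characteristic functions of its members is closed in $\{0,1\}^{\mathbb{N}}$). A family $\mathcal{F}$ is thin if no element of $\mathcal{F}$ is a proper initial segment of another element of $\mathcal{F}$. $\mathcal{F}$ is regular thin if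 it is thin and $\widehat{\mathcal{F}}$ is regular. A tuple $(s_j)_{j=1}^l$ of nonempty finite subsets of $\mathbb{N}$ is a plegma family if (i) $s_i(k)<s_j(k)$ whenever $i<j$ and $k\leq\min(|s_i|,|s_j|)$; and (ii) for all $i,j\in\{1,\dots,l\}$, $s_i(k)<s_j(k+1)$ whenever $k\leq\min(|s_i|,|s_j|-1)$. $\mathrm{Plm}_l(\mathcal{F})$ is the set of all plegma families $(s_j)_{j=1}^l$ with $s_1,\dots,s_l\in\mathcal{F}$. *)

theory Defs
  imports "HOL-Analysis.Function_Topology"
begin

text \<open>
  The natural numbers of the source start at 1, so they are rendered as the set
  \<open>{1..} :: nat set\<close>; the set of finite subsets of \<open>M\<close> is \<^term>\<open>Fpow M\<close>.
\<close>

abbreviation pos_nats :: "nat set" where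
  "pos_nats \<equiv> {1..}"

text \<open>
  The \<open>k\<close>-th element \<open>s(k)\<close>, counted from 1, whereas \<^const>\<open>enumerate\<close> counts from 0.
  Only meaningful for \<open>k \<ge> 1\<close> and, if \<open>s\<close> is finite, \<open>k \<le> card s\<close>.
\<close>

definition elt :: "nat set \<Rightarrow> nat \<Rightarrow> nat" where
  "elt s k = enumerate s (k - 1)"

definition initial_segment :: "nat set \<Rightarrow> nat set \<Rightarrow> bool" where
  "initial_segment t s \<longleftrightarrow> t \<subseteq> s \<and> (\<forall>y\<in>t. \<forall>x\<in>s. x < y \<longrightarrow> x \<in> t)"

definition family_restrict :: "nat set set \<Rightarrow> nat set \<Rightarrow> nat set set" where
  "family_restrict F M = F \<inter> Fpow M"

definition family_hat :: "nat set set \<Rightarrow> nat set set" where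
  "family_hat F = {t \<in> Fpow pos_nats. \<exists>s\<in>F. initial_segment t s}"

definition hereditary_family :: "nat set set \<Rightarrow> bool" where
  "hereditary_family R \<longleftrightarrow> (\<forall>s\<in>R. \<forall>t. t \<subseteq> s \<longrightarrow> t \<in> R)"

definition spreading_family :: "nat set set \<Rightarrow> bool" where
  "spreading_family R \<longleftrightarrow>
     (\<forall>s\<in>R. \<forall>t\<in>Fpow pos_nats.
        card t = card s \<and> (\<forall>k\<in>{1..card s}. elt s k \<le> elt t k) \<longrightarrow> t \<in> R)"

text \<open>
  Points of the product space are functions that are \<^const>\<open>undefined\<close> outside the index set,
  hence the restriction of the characteristic functions.
\<close>

definition compact_family :: "nat set set \<Rightarrow> bool" where
  "compact_family R \<longleftrightarrow>
     closedin (product_topology (\<lambda>_. discrete_topology {0, 1 :: nat}) pos_nats)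
       ((\<lambda>s. restrict (indicator s) pos_nats) ` R)"

definition regular_family :: "nat set set \<Rightarrow> bool" where
  "regular_family R \<longleftrightarrow>
     R \<noteq> {} \<and> R \<subseteq> Fpow pos_nats \<and>
     hereditary_family R \<and> spreading_family R \<and> compact_family R"

definition thin_family :: "nat set set \<Rightarrow> bool" where
  "thin_family F \<longleftrightarrow> \<not> (\<exists>s\<in>F. \<exists>t\<in>F. initial_segment t s \<and> t \<noteq> s)"

definition regular_thin :: "nat set set \<Rightarrow> bool" where
  "regular_thin F \<longleftrightarrow>
     F \<subseteq> Fpow pos_nats \<and> thin_family F \<and> regular_family (family_hat F)"

text \<open>
  Tuples are lists, so the positions \<open>i\<close>, \<open>j\<close> in the tuple count from 0, while the positions
  \<open>k\<close> inside the sets count from 1.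
\<close>

definition plegma :: "nat set list \<Rightarrow> bool" where
  "plegma ss \<longleftrightarrow>
     (\<forall>s\<in>set ss. s \<noteq> {} \<and> s \<in> Fpow pos_nats) \<and>
     (\<forall>i<length ss. \<forall>j<length ss. i < j \<longrightarrow>
        (\<forall>k\<ge>1. k \<le> min (card (ss ! i)) (card (ss ! j)) \<longrightarrow>
           elt (ss ! i) k < elt (ss ! j) k)) \<and>
     (\<forall>i<length ss. \<forall>j<length ss.
        (\<forall>k\<ge>1. k \<le> min (card (ss ! i)) (card (ss ! j) - 1) \<longrightarrow>
           elt (ss ! i) k < elt (ss ! j) (k + 1)))"

definition Plm :: "nat \<Rightarrow> nat set set \<Rightarrow> nat set list set" where
  "Plm l F = {ss. length ss = l \<and> plegma ss \<and> set ss \<subseteq> F}"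

end

theory Submission
  imports Defs
begin

text \<open>
  The partition of plegma families is turned into a partition of a thin family of finite sets, to
  which the Nash-Williams theorem applies.

  Write a plegma family as an array whose row \<open>j\<close> lists \<open>s\<^sub>j\<close> in increasing order. The two plegma
  conditions say exactly that reading this array column by column lists its entries in
  increasing order: (i) compares entries of the same column and (ii) entries of consecutive
  columns (\<open>plegma_lex_less\<close>). Hence the union \<open>U\<close> of the rows, listed increasingly, can be decoded:
  its elements are handed out to the rows in turn, and a row leaves the game as soon as the
  elements it has received form a member of \<open>F\<close>. Since \<open>F\<close> is thin, a row cannot stop earlier or
  later than that, so the decoding is forced. It reads \<open>U\<close> from left to right, so two plegma
  families of the same length are equal as soon as the union of one is an initial segment of the
  union of the other (\<open>plegma_eq_if_initial_segment\<close>). In other words, taking unions is injective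
  on the plegma families of length \<open>l\<close> in \<open>F\<close>, and the unions form a thin family.

  The Nash-Williams theorem (\<open>nash_williams\<close>) yields an infinite \<open>L \<subseteq> M\<close> such that all the
  unions contained in \<open>L\<close> come from one class of the partition, and by injectivity so do the plegma
  families themselves. The theorem rests on Galvin's dichotomy (\<open>galvin_dichotomy\<close>): for every family
  \<open>G\<close>, some infinite \<open>N \<subseteq> M\<close> either contains no finite member of \<open>G\<close> or has the property that
  each of its infinite subsets begins with a member of \<open>G\<close>. This is combinatorial forcing, and both
  of its diagonal arguments are instances of one fusion lemma (\<open>fusion\<close>).
\<close>

section \<open>The Nash-Williams theorem for thin families\<close>

definition above :: "nat set \<Rightarrow> nat set \<Rightarrow> nat set" where
  "above s A = {n \<in> A. \<forall>x\<in>s. x < n}"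

lemma above_mono: "A \<subseteq> B \<Longrightarrow> above s A \<subseteq> above s B"
  by (auto simp: above_def)

lemma above_subset: "above s A \<subseteq> A"
  by (auto simp: above_def)

lemma above_above: "above s (above s A) = above s A"
  by (auto simp: above_def)

lemma infinite_above:
  assumes "finite s" "infinite A"
  shows "infinite (above s A)"
proof
  assume "finite (above s A)"
  moreover have "A \<subseteq> above s A \<union> (\<Union>x\<in>s. {..x})"
    by (auto simp: above_def not_less)
  ultimately show False
    using assms by (meson finite_UN finite_UnI finite_atMost finite_subset)
qed

text \<open>
  A diagonal construction: choose \<open>f 0 \<supseteq> f 1 \<supseteq> \<dots>\<close> such that \<open>f (k + 1)\<close> lies above \<open>n k = min (f k)\<close>
  and is good for every \<open>s \<subseteq> {..n k}\<close>, and let \<open>N\<close> consist of the \<open>n k\<close>. If \<open>s \<subseteq> N\<close> has maximum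
  \<open>n k\<close>, the part of \<open>N\<close> above \<open>s\<close> lies in \<open>f (k + 1)\<close>.
\<close>

lemma fusion:
  fixes Q :: "nat set \<Rightarrow> nat set \<Rightarrow> bool"
  assumes "infinite M"
    and anti: "\<And>s A B. Q s A \<Longrightarrow> B \<subseteq> A \<Longrightarrow> Q s B"
    and dense: "\<And>s A. finite s \<Longrightarrow> infinite A \<Longrightarrow> A \<subseteq> M \<Longrightarrow> \<exists>B\<subseteq>A. infinite B \<and> Q s B"
  shows "\<exists>N\<subseteq>M. infinite N \<and> (\<forall>s. finite s \<longrightarrow> s \<subseteq> N \<longrightarrow> Q s (above s N))"
proof -
  have dense_many: "\<exists>B\<subseteq>A. infinite B \<and> (\<forall>s\<in>S. Q s B)"
    if "finite S" "\<forall>s\<in>S. finite s" "infinite A" "A \<subseteq> M" for S A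
    using that
  proof (induction S arbitrary: A rule: finite_induct)
    case empty
    then show ?case by auto
  next
    case (insert s S)
    then obtain B where B: "B \<subseteq> A" "infinite B" "\<forall>s\<in>S. Q s B"
      by (metis insertCI)
    then obtain C where "C \<subseteq> B" "infinite C" "Q s C"
      using dense[of s B] insert.prems by auto
    then show ?case
      using B anti by (intro exI[of _ C]) auto
  qed
  \<comment> \<open>The empty set has no maximum and its \<open>above\<close>-part is all of \<open>N\<close>, so \<open>f 0\<close> must be good for it.\<close>
  define ok where "ok k A \<longleftrightarrow> infinite A \<and> A \<subseteq> M \<and> (k = 0 \<longrightarrow> Q {} A)" for k :: nat and A
  define next_ok where
    "next_ok A B \<longleftrightarrow> B \<subseteq> A \<and> B \<subseteq> {Inf A<..} \<and> (\<forall>s\<subseteq>{..Inf A}. Q s B)" for A B :: "nat set"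
  have "\<exists>A. ok 0 A"
    using dense[of "{}" M] \<open>infinite M\<close> by (auto simp: ok_def)
  moreover have "\<exists>B. ok (Suc k) B \<and> next_ok A B" if "ok k A" for k A
  proof -
    have A: "infinite A" "A \<subseteq> M"
      using that by (auto simp: ok_def)
    have "infinite (A \<inter> {Inf A<..})"
      using infinite_above[of "{Inf A}" A] A by (simp add: above_def Int_def)
    then obtain B where "B \<subseteq> A \<inter> {Inf A<..}" "infinite B" "\<forall>s\<in>Pow {..Inf A}. Q s B"
      using dense_many[of "Pow {..Inf A}" "A \<inter> {Inf A<..}"] A finite_subset
      by (metis PowD finite_Pow_iff finite_atMost inf.coboundedI1)
    then show ?thesis
      using A by (intro exI[of _ B]) (auto simp: ok_def next_ok_def)
  qed
  ultimately obtain f where f: "\<And>k. ok k (f k)" "\<And>k. next_ok (f k) (f (Suc k))"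
    using dependent_nat_choice[of ok "\<lambda>_. next_ok"] by blast
  define n where "n k = Inf (f k)" for k
  have n_in: "n k \<in> f k" for k
    using f(1)[of k] Inf_nat_def1 unfolding n_def ok_def by (metis finite.emptyI)
  have dec: "f j \<subseteq> f i" if "i \<le> j" for i j
    using f(2) by (intro lift_Suc_antimono_le[OF _ that]) (auto simp: next_ok_def)
  have later: "n j \<in> f (Suc i)" if "i < j" for i j
    using n_in[of j] dec[of "Suc i" j] that by auto
  have less: "n i < n j" if "i < j" for i j
    using later[OF that] f(2)[of i] by (auto simp: next_ok_def n_def)
  have n_mono: "n i < n j \<longleftrightarrow> i < j" for i j
    using less[of i j] less[of j i] by (cases i j rule: linorder_cases) auto
  have "inj n"
    using n_mono by (metis injI less_irrefl nat_neq_iff)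
  then have "infinite (range n)"
    using range_inj_infinite by blast
  moreover have "range n \<subseteq> M"
    using n_in f(1) unfolding ok_def by blast
  moreover have "Q s (above s (range n))" if s: "finite s" "s \<subseteq> range n" for s
  proof (cases "s = {}")
    case True
    have "range n \<subseteq> f 0"
      using n_in dec by blast
    then show ?thesis
      using f(1)[of 0] True above_subset anti by (metis ok_def order_trans)
  next
    case False
    then obtain k where k: "Max s = n k"
      using Max_in s by blast
    have "s \<subseteq> {..n k}"
      using k s Max_ge by (metis atMost_iff subsetI)
    then have "Q s (f (Suc k))"
      using f(2)[of k] by (auto simp: next_ok_def n_def)
    moreover have "n k \<in> s"
      using k False s Max_in by metis
    then have "above s (range n) \<subseteq> f (Suc k)"
      using later n_mono by (auto simp: above_def)
    ultimately show ?thesis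
      using anti by blast
  qed
  ultimately show ?thesis
    by blast
qed

text \<open>
  The forcing relation of Galvin's argument. Cutting \<open>B\<close> down to its part above \<open>s\<close> makes
  acceptance of \<open>s\<close> by \<open>A\<close> depend only on the part of \<open>A\<close> above \<open>s\<close>, which is the only part that
  fusion controls.
\<close>

definition accepts :: "nat set set \<Rightarrow> nat set \<Rightarrow> nat set \<Rightarrow> bool" where
  "accepts G A s \<longleftrightarrow>
     (\<forall>B\<subseteq>A. infinite B \<longrightarrow> (\<exists>t\<in>G. initial_segment t (s \<union> above s B)))"

lemma accepts_subset: "accepts G A s \<Longrightarrow> B \<subseteq> A \<Longrightarrow> accepts G B s"
  by (auto simp: accepts_def)

lemma accepts_above:
  assumes "finite s" "accepts G (above s A) s"
  shows "accepts G A s"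
  unfolding accepts_def
proof (intro allI impI)
  fix B assume "B \<subseteq> A" "infinite B"
  then have "above s B \<subseteq> above s A" "infinite (above s B)"
    using assms infinite_above above_mono by auto
  then show "\<exists>t\<in>G. initial_segment t (s \<union> above s B)"
    using assms(2) above_above unfolding accepts_def by metis
qed

text \<open>
  If infinitely many \<open>n\<close> were bad, the set of all bad \<open>n\<close> would accept \<open>s\<close>: for an infinite subset \<open>C\<close>
  with minimum \<open>n\<close>, the set \<open>s\<close> followed by \<open>C\<close> is the set \<open>insert n s\<close> followed by the rest of \<open>C\<close>.
\<close>

lemma accepts_insert_finite:
  assumes "finite s" and rej: "\<And>B. B \<subseteq> N \<Longrightarrow> infinite B \<Longrightarrow> \<not> accepts G B s"
  shows "finite {n \<in> above s N. accepts G N (insert n s)}" (is "finite ?B")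
proof (rule ccontr)
  assume inf: "infinite ?B"
  have "accepts G ?B s"
  proof (intro accepts_def[THEN iffD2] allI impI)
    fix C assume C: "C \<subseteq> ?B" "infinite C"
    define n where "n = Inf C"
    have n: "n \<in> C" "\<And>c. c \<in> C \<Longrightarrow> n \<le> c"
      using C by (auto simp: n_def intro!: Inf_nat_def1 wellorder_Inf_le1)
    have "C \<subseteq> N"
      using C above_subset by blast
    moreover have "accepts G N (insert n s)"
      using n C by auto
    ultimately obtain t where t: "t \<in> G" "initial_segment t (insert n s \<union> above (insert n s) C)"
      using C(2) unfolding accepts_def by blast
    have "insert n s \<union> above (insert n s) C = s \<union> above s C"
      using n C by (auto simp: above_def order.order_iff_strict)
    then show "\<exists>t\<in>G. initial_segment t (s \<union> above s C)"
      using t by auto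
  qed
  moreover have "?B \<subseteq> N"
    using above_subset by blast
  ultimately show False
    using rej inf by blast
qed

text \<open>
  A first fusion gives an \<open>N\<close> which accepts or rejects each of its finite subsets. If \<open>N\<close> accepts the
  empty set, the second alternative holds. Otherwise a second fusion thins \<open>N\<close> to an \<open>L\<close> along which
  rejection passes from \<open>s\<close> to \<open>insert n s\<close>, so every finite subset of \<open>L\<close> is rejected; members of
  \<open>G\<close> are always accepted, being initial segments of all their end-extensions.
\<close>

lemma galvin_dichotomy:
  assumes "infinite M"
  obtains N where "N \<subseteq> M" "infinite N"
    and "(\<forall>s\<in>G. finite s \<longrightarrow> \<not> s \<subseteq> N) \<or>
         (\<forall>B\<subseteq>N. infinite B \<longrightarrow> (\<exists>t\<in>G. initial_segment t B))"
proof -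
  let ?decides = "\<lambda>s A. accepts G A s \<or> (\<forall>B\<subseteq>A. infinite B \<longrightarrow> \<not> accepts G B s)"
  have "\<exists>N\<subseteq>M. infinite N \<and> (\<forall>s. finite s \<longrightarrow> s \<subseteq> N \<longrightarrow> ?decides s (above s N))"
  proof (rule fusion[OF assms])
    show "?decides s B" if "?decides s A" "B \<subseteq> A" for s A B
      using that accepts_subset by (meson order_trans)
    show "\<exists>B\<subseteq>A. infinite B \<and> ?decides s B" if "infinite A" for s A
      using that by blast
  qed
  then obtain N where N: "N \<subseteq> M" "infinite N"
      and dec: "\<And>s. finite s \<Longrightarrow> s \<subseteq> N \<Longrightarrow> ?decides s (above s N)"
    by blast
  \<comment> \<open>For a deciding \<open>N\<close>, non-acceptance is inherited by all infinite subsets.\<close>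
  have rejects: "\<not> accepts G B s"
    if "finite s" "s \<subseteq> N" "\<not> accepts G N s" "B \<subseteq> N" "infinite B" for s B
    using dec[OF that(1,2)] that accepts_above accepts_subset above_mono above_subset infinite_above
    by metis
  show thesis
  proof (cases "accepts G N {}")
    case True
    then have "\<forall>B\<subseteq>N. infinite B \<longrightarrow> (\<exists>t\<in>G. initial_segment t B)"
      by (simp add: accepts_def above_def)
    then show thesis
      using that N by blast
  next
    case False
    let ?stays = "\<lambda>s A. s \<subseteq> N \<longrightarrow> \<not> accepts G N s \<longrightarrow>
      (\<forall>n\<in>above s A. \<not> accepts G N (insert n s))"
    have "\<exists>L\<subseteq>N. infinite L \<and> (\<forall>s. finite s \<longrightarrow> s \<subseteq> L \<longrightarrow> ?stays s (above s L))"
    proof (rule fusion[OF N(2)])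
      show "?stays s B" if "?stays s A" "B \<subseteq> A" for s A B
        using that above_mono by blast
      show "\<exists>B\<subseteq>A. infinite B \<and> ?stays s B" if s: "finite s" and A: "infinite A" "A \<subseteq> N" for s A
      proof (cases "s \<subseteq> N \<and> \<not> accepts G N s")
        case True
        let ?bad = "{n \<in> above s N. accepts G N (insert n s)}"
        have "finite ?bad"
          using accepts_insert_finite rejects s True by blast
        then have "infinite (A - ?bad)"
          using A by simp
        moreover have "?stays s (A - ?bad)"
          using A by (auto simp: above_def)
        ultimately show ?thesis
          by (meson Diff_subset)
      qed (use A in blast)
    qed
    then obtain L where L: "L \<subseteq> N" "infinite L"
        and stays: "\<And>s. finite s \<Longrightarrow> s \<subseteq> L \<Longrightarrow> ?stays s (above s L)"
      by blast
    \<comment> \<open>Adding elements in increasing order keeps each new one above the set built so far.\<close>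
    have rej: "\<not> accepts G N s" if "finite s" "s \<subseteq> L" for s
      using that
    proof (induction s rule: finite_linorder_max_induct)
      case empty
      then show ?case using False by simp
    next
      case (insert n s)
      then have "n \<in> above s (above s L)"
        by (auto simp: above_def)
      then show ?case
        using insert stays[of s] L by auto
    qed
    have "\<not> s \<subseteq> L" if "s \<in> G" "finite s" for s
    proof
      assume "s \<subseteq> L"
      have "initial_segment s (s \<union> above s B)" for B
        by (auto simp: initial_segment_def above_def)
      then have "accepts G N s"
        using that by (auto simp: accepts_def)
      then show False
        using rej that \<open>s \<subseteq> L\<close> by blast
    qed
    then show thesis
      using that L N by (metis order_trans)
  qed
qed

lemma initial_segments_comparable:
  assumes "initial_segment s B" "initial_segment t B"
  shows "initial_segment s t \<or> initial_segment t s"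
proof (rule ccontr)
  assume "\<not> ?thesis"
  moreover have "s \<subseteq> B" "t \<subseteq> B"
    using assms by (auto simp: initial_segment_def)
  ultimately have "\<not> s \<subseteq> t" "\<not> t \<subseteq> s"
    using assms unfolding initial_segment_def by blast+
  then obtain x y where xy: "x \<in> s" "x \<notin> t" "y \<in> t" "y \<notin> s"
    by blast
  then have "x < y \<or> y < x"
    by (metis linorder_neqE_nat)
  then show False
    using xy assms \<open>s \<subseteq> B\<close> \<open>t \<subseteq> B\<close> unfolding initial_segment_def by blast
qed

text \<open>
  Galvin's dichotomy for \<open>F \<inter> G\<close>. In its second alternative, extend a member \<open>s\<close> of \<open>F\<close> in \<open>N\<close> to an
  infinite subset of \<open>N\<close>; this also begins with a member of \<open>F \<inter> G\<close>, which is comparable with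
  \<open>s\<close> and so equals \<open>s\<close> by thinness.
\<close>

lemma nash_williams_dichotomy:
  assumes "infinite M" "thin_family F"
  obtains N where "N \<subseteq> M" "infinite N"
    and "F \<inter> Fpow N \<subseteq> G \<or> F \<inter> Fpow N \<inter> G = {}"
proof -
  obtain N where N: "N \<subseteq> M" "infinite N"
    and dich: "(\<forall>s\<in>F \<inter> G. finite s \<longrightarrow> \<not> s \<subseteq> N) \<or>
         (\<forall>B\<subseteq>N. infinite B \<longrightarrow> (\<exists>t\<in>F \<inter> G. initial_segment t B))"
    using galvin_dichotomy[OF assms(1)] by metis
  from dich show thesis
  proof
    assume "\<forall>s\<in>F \<inter> G. finite s \<longrightarrow> \<not> s \<subseteq> N"
    then have "F \<inter> Fpow N \<inter> G = {}"
      by (auto simp: Fpow_def)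
    then show thesis
      using that N by blast
  next
    assume init: "\<forall>B\<subseteq>N. infinite B \<longrightarrow> (\<exists>t\<in>F \<inter> G. initial_segment t B)"
    have "s \<in> G" if s: "s \<in> F" "finite s" "s \<subseteq> N" for s
    proof -
      let ?B = "s \<union> above s N"
      have "?B \<subseteq> N" "infinite ?B"
        using s N infinite_above above_subset by auto
      then obtain t where t: "t \<in> F" "t \<in> G" "initial_segment t ?B"
        using init by blast
      moreover have "initial_segment s ?B"
        by (auto simp: initial_segment_def above_def)
      ultimately have "s = t"
        using initial_segments_comparable s \<open>thin_family F\<close> unfolding thin_family_def by metis
      then show ?thesis
        using t by simp
    qed
    then have "F \<inter> Fpow N \<subseteq> G"
      by (auto simp: Fpow_def)
    then show thesis
      using that N by blast
  qed
qed

theorem nash_williams: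
  assumes "finite I" "I \<noteq> {}" "infinite M" "thin_family F" "F \<inter> Fpow M \<subseteq> (\<Union>i\<in>I. G i)"
  shows "\<exists>L\<subseteq>M. infinite L \<and> (\<exists>i\<in>I. F \<inter> Fpow L \<subseteq> G i)"
  using assms
proof (induction I arbitrary: M rule: finite_ne_induct)
  case (singleton i)
  then show ?case by auto
next
  case (insert i I)
  obtain N where N: "N \<subseteq> M" "infinite N"
    and dich: "F \<inter> Fpow N \<subseteq> G i \<or> F \<inter> Fpow N \<inter> G i = {}"
    using nash_williams_dichotomy[OF insert.prems(1,2)] by metis
  from dich show ?case
  proof
    assume "F \<inter> Fpow N \<subseteq> G i"
    then show ?thesis using N by blast
  next
    assume "F \<inter> Fpow N \<inter> G i = {}"
    moreover have "Fpow N \<subseteq> Fpow M"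
      using N Fpow_mono by blast
    ultimately have "F \<inter> Fpow N \<subseteq> (\<Union>i\<in>I. G i)"
      using insert.prems(3) by blast
    then show ?thesis
      using insert.IH[OF N(2) insert.prems(2)] N by (meson insertCI order_trans)
  qed
qed

section \<open>Plegma families and their unions\<close>

lemma finite_set_eq_enumerate_image:
  fixes s :: "nat set"
  assumes "finite s"
  shows "s = enumerate s ` {..<card s}"
proof (intro equalityI subsetI)
  fix x assume "x \<in> s"
  then show "x \<in> enumerate s ` {..<card s}"
    using finite_enumerate_Ex[OF assms] by blast
qed (use assms finite_enumerate_in_set in blast)

lemma initial_segmentI_enumerate:
  assumes "finite s" "finite t" "card t \<le> card s"
    and "\<And>k. k < card t \<Longrightarrow> enumerate t k = enumerate s k"
  shows "initial_segment t s"
  unfolding initial_segment_def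
proof (intro conjI ballI impI)
  have t: "t = enumerate s ` {..<card t}"
    using finite_set_eq_enumerate_image[OF assms(2)] assms(4) by (auto simp: image_iff)
  have s: "s = enumerate s ` {..<card s}"
    using finite_set_eq_enumerate_image[OF assms(1)] .
  show "t \<subseteq> s"
    using s t assms(3) by (metis image_mono lessThan_subset_iff)
  fix y x assume "y \<in> t" "x \<in> s" "x < y"
  then obtain k m where "y = enumerate s k" "k < card t" "x = enumerate s m" "m < card s"
    using s t by blast
  moreover from this have "m < k"
    using \<open>x < y\<close> assms(1,3) finite_enumerate_mono[of k m s]
    by (metis linorder_neqE_nat order_less_asym order_less_irrefl)
  ultimately show "x \<in> t"
    using t by (metis image_eqI lessThan_iff order_less_trans)
qed

text \<open>
  Column by column, the entries of a plegma family increase. Condition (ii) bridges consecutive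
  columns only; longer distances are covered by moving along row \<open>j\<close>.
\<close>

lemma plegma_lex_less:
  assumes "plegma ss" "i < length ss" "j < length ss"
    and "k < card (ss ! i)" "m < card (ss ! j)"
    and "k < m \<or> k = m \<and> i < j"
  shows "enumerate (ss ! i) k < enumerate (ss ! j) m"
  using assms(6)
proof
  assume "k < m"
  have step: "enumerate (ss ! i) k < enumerate (ss ! j) (Suc k)"
  proof -
    have "\<forall>i<length ss. \<forall>j<length ss.
        (\<forall>k\<ge>1. k \<le> min (card (ss ! i)) (card (ss ! j) - 1) \<longrightarrow>
           elt (ss ! i) k < elt (ss ! j) (k + 1))"
      using assms(1) by (simp add: plegma_def)
    then have "elt (ss ! i) (Suc k) < elt (ss ! j) (Suc k + 1)"
      using assms(2-5) \<open>k < m\<close> by simp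
    then show ?thesis
      by (simp add: elt_def)
  qed
  show ?thesis
  proof (cases "m = Suc k")
    case False
    have "finite (ss ! j)"
      using assms(5) card.infinite by fastforce
    then have "enumerate (ss ! j) (Suc k) < enumerate (ss ! j) m"
      using finite_enumerate_mono False \<open>k < m\<close> assms(5) by auto
    then show ?thesis
      using step by simp
  qed (use step in simp)
next
  assume "k = m \<and> i < j"
  moreover have "\<forall>i<length ss. \<forall>j<length ss. i < j \<longrightarrow>
        (\<forall>k\<ge>1. k \<le> min (card (ss ! i)) (card (ss ! j)) \<longrightarrow>
           elt (ss ! i) k < elt (ss ! j) k)"
    using assms(1) by (simp add: plegma_def)
  ultimately have "elt (ss ! i) (Suc k) < elt (ss ! j) (Suc m)"
    using assms(2-5) by simp
  then show ?thesis
    by (simp add: elt_def)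
qed

lemma plegma_lex_less_iff:
  assumes "plegma ss" "i < length ss" "j < length ss"
    and "k < card (ss ! i)" "m < card (ss ! j)"
  shows "enumerate (ss ! i) k < enumerate (ss ! j) m \<longleftrightarrow> k < m \<or> k = m \<and> i < j"
  using plegma_lex_less[OF assms] plegma_lex_less[OF assms(1,3,2,5,4)]
  by (metis linorder_neqE_nat order_less_asym order_less_irrefl)

lemma finite_plegma_member: "plegma ss \<Longrightarrow> j < length ss \<Longrightarrow> finite (ss ! j)"
  by (auto simp: plegma_def Fpow_def)

lemma in_Union_plegmaE:
  assumes "plegma ss" "x \<in> \<Union>(set ss)"
  obtains i k where "i < length ss" "k < card (ss ! i)" "x = enumerate (ss ! i) k"
proof -
  from assms(2) obtain i where i: "i < length ss" "x \<in> ss ! i"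
    by (auto simp: in_set_conv_nth)
  then obtain k where "k < card (ss ! i)" "enumerate (ss ! i) k = x"
    using finite_enumerate_Ex[OF finite_plegma_member[OF assms(1) i(1)]] by blast
  then show thesis
    using that i(1) by blast
qed

lemma enumerate_in_Union_plegma:
  assumes "plegma ss" "i < length ss" "k < card (ss ! i)"
  shows "enumerate (ss ! i) k \<in> \<Union>(set ss)"
proof -
  have "enumerate (ss ! i) k \<in> ss ! i"
    using finite_enumerate_in_set finite_plegma_member assms by metis
  then show ?thesis
    using nth_mem[OF assms(2)] by blast
qed

text \<open>
  The decoding argument, as a lexicographic induction over the positions (column \<open>k\<close>, row \<open>j\<close>): both
  arrays agree at each position, in that the entry exists in both or in neither, and has the same
  value. If just one of the two rows had ended before column \<open>k\<close>, it would be a proper initial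
  segment of the other one, against thinness. If both entries exist, they are the least elements
  of the respective unions that have not been read yet, and these coincide because one union is
  an initial segment of the other.
\<close>

lemma plegma_eq_if_initial_segment:
  assumes F: "thin_family F" "set ss \<subseteq> F" "set ts \<subseteq> F"
    and ss: "plegma ss" and ts: "plegma ts" and len: "length ss = length ts"
    and init: "initial_segment (\<Union>(set ss)) (\<Union>(set ts))"
  shows "ss = ts"
proof -
  define agree where "agree k j \<longleftrightarrow> (k < card (ss ! j) \<longleftrightarrow> k < card (ts ! j)) \<and>
    (k < card (ss ! j) \<longrightarrow> enumerate (ss ! j) k = enumerate (ts ! j) k)" for k j
  have agree: "j < length ts \<longrightarrow> agree k j" for k j
  proof (induction "(k, j)" arbitrary: k j rule: wf_induct[OF wf_lex_prod[OF wf_less_than wf_less_than]])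
    case (1 k j)
    show ?case
    proof
      assume j: "j < length ts"
      have IH: "agree m i" if "m < k \<or> m = k \<and> i < j" "i < length ts" for m i
        using 1 that by auto
      have fin: "finite (ss ! j)" "finite (ts ! j)"
        using finite_plegma_member ss ts j len by auto
      have mem: "ss ! j \<in> F" "ts ! j \<in> F"
        using F j len by (auto simp: subset_iff)
      have card_iff: "k < card (ss ! j) \<longleftrightarrow> k < card (ts ! j)"
      proof (rule ccontr)
        assume ne: "(k < card (ss ! j)) \<noteq> (k < card (ts ! j))"
        then consider "card (ts ! j) \<le> k" "k < card (ss ! j)"
          | "card (ss ! j) \<le> k" "k < card (ts ! j)"
          by linarith
        then have "initial_segment (ts ! j) (ss ! j) \<or> initial_segment (ss ! j) (ts ! j)"
        proof cases
          case 1
          then show ?thesis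
            using IH[OF _ j] fin by (intro disjI1 initial_segmentI_enumerate) (auto simp: agree_def)
        next
          case 2
          then show ?thesis
            using IH[OF _ j] fin by (intro disjI2 initial_segmentI_enumerate) (auto simp: agree_def)
        qed
        then have "ss ! j = ts ! j"
          using mem F(1) by (auto simp: thin_family_def)
        then show False using ne by simp
      qed
      moreover have "enumerate (ss ! j) k = enumerate (ts ! j) k" (is "?x = ?y")
        if k: "k < card (ss ! j)"
      proof (rule ccontr)
        assume "?x \<noteq> ?y"
        have k': "k < card (ts ! j)" using k card_iff by simp
        have x: "?x \<in> \<Union>(set ss)"
          using enumerate_in_Union_plegma ss j k len by metis
        have y: "?y \<in> \<Union>(set ts)"
          using enumerate_in_Union_plegma ts j k' by metis
        consider "?x < ?y" | "?y < ?x"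
          using \<open>?x \<noteq> ?y\<close> by linarith
        then show False
        proof cases
          \<comment> \<open>The smaller value occurs in the other array too, there at an earlier position; by
            induction it already occurs at that position in its own array.\<close>
          case 1
          have "?x \<in> \<Union>(set ts)"
            using x init by (auto simp: initial_segment_def)
          then obtain i m where im: "i < length ts" "m < card (ts ! i)" "?x = enumerate (ts ! i) m"
            by (rule in_Union_plegmaE[OF ts])
          then have lex: "m < k \<or> m = k \<and> i < j"
            using plegma_lex_less_iff[OF ts im(1) j im(2) k'] 1 by simp
          then have "m < card (ss ! i)" "enumerate (ss ! i) m = ?x"
            using IH[OF lex im(1)] im by (auto simp: agree_def)
          then show False
            using plegma_lex_less[OF ss, of i j m k] lex im j k len by simp
        next
          case 2
          \<comment> \<open>Here the value lies in the longer union, below an element of its initial segment.\<close>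
          have "?y \<in> \<Union>(set ss)"
            using x y 2 init unfolding initial_segment_def by blast
          then obtain i m where im: "i < length ss" "m < card (ss ! i)" "?y = enumerate (ss ! i) m"
            by (rule in_Union_plegmaE[OF ss])
          then have lex: "m < k \<or> m = k \<and> i < j"
            using plegma_lex_less_iff[OF ss im(1) _ im(2) k] j len 2 by simp
          then have "m < card (ts ! i)" "enumerate (ts ! i) m = ?y"
            using IH[OF lex] im len by (auto simp: agree_def)
          then show False
            using plegma_lex_less[OF ts, of i j m k] lex im j k' len by simp
        qed
      qed
      ultimately show "agree k j"
        by (simp add: agree_def)
    qed
  qed
  show ?thesis
  proof (rule nth_equalityI[OF len])
    fix j assume j: "j < length ss"
    have fin: "finite (ss ! j)" "finite (ts ! j)"
      using finite_plegma_member ss ts j len by auto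
    have ag: "agree k j" for k
      using agree j len by simp
    then have "card (ss ! j) = card (ts ! j)"
      by (metis agree_def linorder_neqE_nat order_less_irrefl)
    then have "enumerate (ss ! j) ` {..<card (ss ! j)} = enumerate (ts ! j) ` {..<card (ts ! j)}"
      using ag by (auto simp: agree_def image_iff)
    then show "ss ! j = ts ! j"
      using fin finite_set_eq_enumerate_image by metis
  qed
qed

section \<open>The Ramsey property of plegma families\<close>

theorem theorem3p5:
  fixes M :: "nat set" and l p :: nat and F :: "nat set set"
    and P :: "nat \<Rightarrow> nat set list set"
  assumes "M \<subseteq> pos_nats" and "infinite M"
    and "l \<ge> 1"
    and "regular_thin F"
    and "p \<ge> 1"
    and "Plm l (family_restrict F M) = (\<Union>i\<in>{1..p}. P i)"
    and "disjoint_family_on P {1..p}"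
  shows "\<exists>L i0. L \<subseteq> M \<and> infinite L \<and> i0 \<in> {1..p} \<and>
           Plm l (family_restrict F L) \<subseteq> P i0"
proof -
  let ?union = "\<lambda>ss :: nat set list. \<Union>(set ss)"
  let ?U = "?union ` Plm l F"
  have "thin_family F"
    using assms(4) by (simp add: regular_thin_def)
  then have eqI: "ss = ts"
    if "ss \<in> Plm l F" "ts \<in> Plm l F" "initial_segment (?union ss) (?union ts)" for ss ts
    using that plegma_eq_if_initial_segment[of F ss ts] by (simp add: Plm_def)
  have "thin_family ?U"
    unfolding thin_family_def using eqI by blast
  have restrict: "ss \<in> Plm l (family_restrict F A) \<longleftrightarrow> ss \<in> Plm l F \<and> ?union ss \<in> Fpow A" for ss A
    by (auto simp: Plm_def family_restrict_def Fpow_def plegma_def)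
  have "?U \<inter> Fpow M \<subseteq> (\<Union>i\<in>{1..p}. ?union ` P i)"
  proof
    fix u assume "u \<in> ?U \<inter> Fpow M"
    then obtain ss where "ss \<in> Plm l (family_restrict F M)" "u = ?union ss"
      using restrict by blast
    then show "u \<in> (\<Union>i\<in>{1..p}. ?union ` P i)"
      using assms(6) by blast
  qed
  then obtain L i where L: "L \<subseteq> M" "infinite L" and i: "i \<in> {1..p}"
      and hom: "?U \<inter> Fpow L \<subseteq> ?union ` P i"
    using nash_williams[of "{1..p}" M ?U "\<lambda>i. ?union ` P i"] \<open>thin_family ?U\<close> assms(2,5)
    by auto
  have "Plm l (family_restrict F L) \<subseteq> P i"
  proof
    fix ss assume "ss \<in> Plm l (family_restrict F L)"
    then have ss: "ss \<in> Plm l F" "?union ss \<in> Fpow L"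
      using restrict by auto
    then obtain ts where ts: "ts \<in> P i" "?union ss = ?union ts"
      using hom by blast
    then have "ts \<in> Plm l F"
      using assms(6) i restrict by blast
    moreover have "initial_segment (?union ss) (?union ts)"
      using ts by (auto simp: initial_segment_def)
    ultimately show "ss \<in> P i"
      using eqI ss ts by metis
  qed
  then show ?thesis
    using L i by blast
qed

end
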